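(* Consider a mapping $F:\mathbb{R}^n\times\mathbb{R}^m\rightrightarrows\mathbb{R}^l$ and let $S(x):=\{y\in\mathbb{R}^m : 0\in F(x,y)\}$, $x\in\mathbb{R}^n$, be the solution map of the inclusion $0\in F(x,y)$. Assume that $(\bar x,\bar y)\in\mathrm{gph}\,S$ is such that the qualification condition $$(0,0)\in D^*F(\bar x,\bar y,0)(z^* )\ \Rightarrow\ z^*=0$$ holds. Then there is a neighborhood $U$ of $(\bar x,\bar y)$ such that for all $(x,y)\in\mathrm{gph}\,S\cap U$ one has $$D^*S(x,y)(y^* )\subset\Sigma(x,y)(y^* ):=\{x^* : \exists z^*\in\mathbb{R}^l\text{ with }(x^*,-y^* )\in D^*F(x,y,0)(z^* )\},\quad y^*\in\mathbb{R}^m.$$ Moreover, for such $(x,y)$, $S$ is semismooth$^*$ at $(x,y)$ with respect to the mapping $\Gamma:\mathbb{R}^n\times\mathbb{R}^m\rightrightarrows\mathbb{R}^m\times\mathbb{R}^n$ given by $\Gamma(u,v)=\{(y^*,x^* ) : x^*\in\Sigma(u,v)(y^* )\}$, provided $F$ is semismooth$^*$ at $(x,y,0)$.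
   Context: For a multifunction $G:\mathbb{R}^p\rightrightarrows\mathbb{R}^q$: $\mathrm{gph}\,G=\{(x,y) : y\in G(x)\}$, $\mathrm{dom}\,G=\{x : G(x)\neq\emptyset\}$. For a set $\Omega\subset\mathbb{R}^s$ and $z\in\Omega$: tangent cone $T_\Omega(z)=\{w : \exists t_k\downarrow0,\ w_k\to w,\ z+t_kw_k\in\Omega\}$; regular normal cone $\widehat N_\Omega(z)=(T_\Omega(z))^\circ$ (negative polar cone); limiting normal cone $N_\Omega(\bar z)=\{z^* : \exists z_k\to\bar z,\ z_k\in\Omega,\ z_k^*\in\widehat N_\Omega(z_k),\ z_k^*\to z^*\}$. The limiting coderivative of $G$ at $(\bar x,\bar y)\in\mathrm{gph}\,G$ is the multifunction $D^*G(\bar x,\bar y):\mathbb{R}^q\rightrightarrows\mathbb{R}^p$ with $x^*\in D^*G(\bar x,\bar y)(y^* )$ iff $(x^*,-y^* )\in N_{\mathrm{gph}\,G}(\bar x,\bar y)$. For $F:\mathbb{R}^n\times\mathbb{R}^m\rightrightarrows\mathbb{R}^l$, $D^*F(x,y,z)$ maps $\mathbb{R}^l$ into subsets of $\mathbb{R}^n\times\mathbb{R}^m$. $G:\mathbb{R}^p\rightrightarrows\mathbb{R}^q$ is semismooth$^*$ with respect to $\Gamma:\mathbb{R}^p\times\mathbb{R}^q\rightrightarrows\mathbb{R}^q\times\mathbb{R}^p$ at $(\bar x,\bar y)\in\mathrm{gph}\,G$ if: (1) $\Gamma$ is cone-valued (each nonempty value is a, not necessarily convex, cone); (2) there is a neighborhood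 $N$ of $(\bar x,\bar y)$ with $\mathrm{gph}\,G\cap N\subset\mathrm{dom}\,\Gamma$; (3) for every $\epsilon>0$ there is $\delta>0$ such that $|\langle x^*,x-\bar x\rangle-\langle y^*,y-\bar y\rangle|\le\epsilon\|(x,y)-(\bar x,\bar y)\|\,\|(y^*,x^* )\|$ for all $(x,y)\in\mathrm{gph}\,G$ with $\|(x,y)-(\bar x,\bar y)\|\le\delta$ and all $(y^*,x^* )\in\Gamma(x,y)$. $G$ is semismooth$^*$ at $(\bar x,\bar y)$ (without qualifier) if this holds with $\Gamma(x,y)=\mathrm{gph}\,D^*G(x,y)$.
   Formalization: The graph of F is additionally assumed to be locally closed at the point (x̄,ȳ,0); without this the claim fails, e.g. for F(x,y)=ℝ\{0} when (x,y)≠(0,0) and F(0,0)=ℝ. *)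

theory Defs
  imports "HOL-Analysis.Analysis"
begin

text \<open>A multifunction from \<open>'a\<close> to \<open>'b\<close> is a set-valued function \<open>'a \<Rightarrow> 'b set\<close>.
  The norm and inner product on product types are the Euclidean ones.\<close>

definition gph :: "('a \<Rightarrow> 'b set) \<Rightarrow> ('a \<times> 'b) set" where
  "gph G = {(x, y). y \<in> G x}"

definition mdom :: "('a \<Rightarrow> 'b set) \<Rightarrow> 'a set" where
  "mdom G = {x. G x \<noteq> {}}"

definition tangent_cone :: "'a::euclidean_space set \<Rightarrow> 'a \<Rightarrow> 'a set" where
  "tangent_cone \<Omega> z =
     {w. \<exists>(t :: nat \<Rightarrow> real) (v :: nat \<Rightarrow> 'a).
           (\<forall>k. t k > 0) \<and> t \<longlonglongrightarrow> 0 \<and> v \<longlonglongrightarrow> w \<and> (\<forall>k. z + t k *\<^sub>R v k \<in> \<Omega>)}"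

definition negative_polar :: "'a::euclidean_space set \<Rightarrow> 'a set" where
  "negative_polar K = {v. \<forall>w\<in>K. v \<bullet> w \<le> 0}"

definition regular_normal_cone :: "'a::euclidean_space set \<Rightarrow> 'a \<Rightarrow> 'a set" where
  "regular_normal_cone \<Omega> z = negative_polar (tangent_cone \<Omega> z)"

text \<open>The limiting normal cone is only meaningful at points of the set; elsewhere it is
  empty by convention, so that the coderivative is empty off the graph.\<close>

definition limiting_normal_cone :: "'a::euclidean_space set \<Rightarrow> 'a \<Rightarrow> 'a set" where
  "limiting_normal_cone \<Omega> z =
     {zs. z \<in> \<Omega> \<and>
        (\<exists>(u :: nat \<Rightarrow> 'a) (us :: nat \<Rightarrow> 'a).
           u \<longlonglongrightarrow> z \<and> (\<forall>k. u k \<in> \<Omega>) \<and>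
           (\<forall>k. us k \<in> regular_normal_cone \<Omega> (u k)) \<and> us \<longlonglongrightarrow> zs)}"

definition coderivative ::
    "('a::euclidean_space \<Rightarrow> 'b::euclidean_space set) \<Rightarrow> 'a \<Rightarrow> 'b \<Rightarrow> 'b \<Rightarrow> 'a set" where
  "coderivative G x y ys = {xs. (xs, - ys) \<in> limiting_normal_cone (gph G) (x, y)}"

definition semismooth_star_wrt ::
    "('a::euclidean_space \<Rightarrow> 'b::euclidean_space set) \<Rightarrow> ('a \<times> 'b \<Rightarrow> ('b \<times> 'a) set)
     \<Rightarrow> 'a \<Rightarrow> 'b \<Rightarrow> bool" where
  "semismooth_star_wrt G \<Gamma> xb yb \<longleftrightarrow>
     (xb, yb) \<in> gph G \<and>
     (\<forall>p. \<Gamma> p \<noteq> {} \<longrightarrow> cone (\<Gamma> p)) \<and>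
     (\<exists>N. open N \<and> (xb, yb) \<in> N \<and> gph G \<inter> N \<subseteq> mdom \<Gamma>) \<and>
     (\<forall>\<epsilon>>0. \<exists>\<delta>>0. \<forall>(x, y)\<in>gph G. norm ((x, y) - (xb, yb)) \<le> \<delta> \<longrightarrow>
        (\<forall>(ys, xs)\<in>\<Gamma> (x, y).
           \<bar>xs \<bullet> (x - xb) - ys \<bullet> (y - yb)\<bar>
             \<le> \<epsilon> * norm ((x, y) - (xb, yb)) * norm (ys, xs)))"

definition semismooth_star ::
    "('a::euclidean_space \<Rightarrow> 'b::euclidean_space set) \<Rightarrow> 'a \<Rightarrow> 'b \<Rightarrow> bool" where
  "semismooth_star G xb yb \<longleftrightarrow>
     semismooth_star_wrt G (\<lambda>(x, y). gph (coderivative G x y)) xb yb"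

text \<open>The calculus of limiting normal cones needs sets that are locally closed around the reference
  point. Without it the inclusion for solution maps fails: for \<open>F (x, y) = - {0}\<close> if
  \<open>(x, y) \<noteq> (0, 0)\<close> and \<open>F (0, 0) = UNIV\<close> all limiting normals to \<open>gph F\<close> vanish, whereas the
  solution map has graph \<open>{(0, 0)}\<close>.\<close>

definition locally_closed_at :: "'a::metric_space set \<Rightarrow> 'a \<Rightarrow> bool" where
  "locally_closed_at \<Omega> z \<longleftrightarrow> (\<exists>r>0. closed (\<Omega> \<inter> cball z r))"

definition solution_map :: "('a \<times> 'b \<Rightarrow> 'c::zero set) \<Rightarrow> 'a \<Rightarrow> 'b set" where
  "solution_map F x = {y. 0 \<in> F (x, y)}"

text \<open>The multifunctions \<open>\<Sigma>(x,y)\<close> and \<open>\<Gamma>\<close> attached to the inclusion \<open>0 \<in> F(x,y)\<close>.\<close>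

definition Sigma_incl ::
    "('a::euclidean_space \<times> 'b::euclidean_space \<Rightarrow> 'c::euclidean_space set)
     \<Rightarrow> 'a \<Rightarrow> 'b \<Rightarrow> 'b \<Rightarrow> 'a set" where
  "Sigma_incl F x y ys = {xs. \<exists>zs. (xs, - ys) \<in> coderivative F (x, y) 0 zs}"

definition Gamma_incl ::
    "('a::euclidean_space \<times> 'b::euclidean_space \<Rightarrow> 'c::euclidean_space set)
     \<Rightarrow> 'a \<times> 'b \<Rightarrow> ('b \<times> 'a) set" where
  "Gamma_incl F = (\<lambda>(u, v). {(ys, xs). xs \<in> Sigma_incl F u v ys})"

end

theory Submission
  imports Defs
begin

text \<open>The graph of the solution map is the slice \<open>{p. (p, 0) \<in> gph F}\<close>. A regular normal \<open>n\<close> to this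
  slice at \<open>p\<close> is approximated by minimising \<open>|u - (p + t n)|^2 + k |v|^2\<close> over \<open>(u, v)\<close> in the graph
  near \<open>(p, 0)\<close>: for small \<open>t\<close> and large \<open>k\<close> the minimiser is close to \<open>(p, 0)\<close> and optimality
  produces a regular normal to \<open>gph F\<close> whose first component is close to \<open>n\<close>. The qualification
  condition is, by compactness, equivalent to a bound of the second component of the normals to
  \<open>gph F\<close> by a multiple of the first, uniformly near the reference point. This bound yields the
  limits needed for the coderivative inclusion, and it absorbs \<open>z*\<close> in the semismoothness estimate
  of \<open>F\<close>.\<close>

section \<open>Regular and limiting normal cones: scaling and closedness\<close>

lemma zero_in_regular_normal_cone: "0 \<in> regular_normal_cone \<Omega> z"
  by (simp add: regular_normal_cone_def negative_polar_def)

lemma regular_normal_cone_scaleR: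
  assumes "n \<in> regular_normal_cone \<Omega> z" "0 \<le> c"
  shows "c *\<^sub>R n \<in> regular_normal_cone \<Omega> z"
  using assms by (auto simp: regular_normal_cone_def negative_polar_def mult_nonneg_nonpos)

lemma LIMSEQ_dist_le_inverse:
  assumes "\<And>k::nat. dist (u k) z \<le> inverse (real (Suc k))"
  shows "u \<longlonglongrightarrow> z"
  using assms
  by (intro metric_tendsto_imp_tendsto[OF LIMSEQ_inverse_real_of_nat] always_eventually allI)
    (simp del: of_nat_Suc)

text \<open>Tolerances instead of sequences: later diagonal arguments become triangle inequalities.
  Conversely, the tolerances \<open>1 / (k + 1)\<close> give back the sequences.\<close>

lemma limiting_normal_cone_iff:
  "n \<in> limiting_normal_cone \<Omega> z \<longleftrightarrow>
     z \<in> \<Omega> \<and> (\<forall>e>0. \<exists>u\<in>\<Omega>. \<exists>m\<in>regular_normal_cone \<Omega> u. dist u z < e \<and> dist m n < e)"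
proof
  assume "n \<in> limiting_normal_cone \<Omega> z"
  then obtain u us where z: "z \<in> \<Omega>" and u: "u \<longlonglongrightarrow> z" "\<forall>k. u k \<in> \<Omega>"
    and us: "\<forall>k. us k \<in> regular_normal_cone \<Omega> (u k)" "us \<longlonglongrightarrow> n"
    by (auto simp: limiting_normal_cone_def)
  have "\<exists>u\<in>\<Omega>. \<exists>m\<in>regular_normal_cone \<Omega> u. dist u z < e \<and> dist m n < e" if "e > 0" for e
  proof -
    have "\<forall>\<^sub>F k in sequentially. dist (u k) z < e \<and> dist (us k) n < e"
      using tendstoD[OF u(1) that] tendstoD[OF us(2) that] by eventually_elim simp
    then obtain k where "dist (u k) z < e \<and> dist (us k) n < e"
      by (auto simp: eventually_sequentially)
    then show ?thesis using u us by blast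
  qed
  then show "z \<in> \<Omega> \<and> (\<forall>e>0. \<exists>u\<in>\<Omega>. \<exists>m\<in>regular_normal_cone \<Omega> u. dist u z < e \<and> dist m n < e)"
    using z by blast
next
  assume R: "z \<in> \<Omega> \<and> (\<forall>e>0. \<exists>u\<in>\<Omega>. \<exists>m\<in>regular_normal_cone \<Omega> u. dist u z < e \<and> dist m n < e)"
  then have "\<forall>k::nat. \<exists>u m. u \<in> \<Omega> \<and> m \<in> regular_normal_cone \<Omega> u
      \<and> dist u z < inverse (real (Suc k)) \<and> dist m n < inverse (real (Suc k))"
    by (metis inverse_positive_iff_positive of_nat_0_less_iff zero_less_Suc)
  then obtain u us where *: "\<And>k::nat. u k \<in> \<Omega>" "\<And>k. us k \<in> regular_normal_cone \<Omega> (u k)"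
      "\<And>k. dist (u k) z < inverse (real (Suc k))" "\<And>k. dist (us k) n < inverse (real (Suc k))"
    by metis
  have "u \<longlonglongrightarrow> z"
    by (rule LIMSEQ_dist_le_inverse) (rule less_imp_le[OF *(3)])
  moreover have "us \<longlonglongrightarrow> n"
    by (rule LIMSEQ_dist_le_inverse) (rule less_imp_le[OF *(4)])
  ultimately show "n \<in> limiting_normal_cone \<Omega> z"
    using R * by (auto simp: limiting_normal_cone_def)
qed

lemma regular_subset_limiting_normal_cone:
  assumes "z \<in> \<Omega>"
  shows "regular_normal_cone \<Omega> z \<subseteq> limiting_normal_cone \<Omega> z"
proof
  fix n assume "n \<in> regular_normal_cone \<Omega> z"
  then show "n \<in> limiting_normal_cone \<Omega> z"
    using assms unfolding limiting_normal_cone_iff by (metis dist_self)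
qed

lemma limiting_normal_cone_scaleR:
  assumes n: "n \<in> limiting_normal_cone \<Omega> z" and c: "0 \<le> c"
  shows "c *\<^sub>R n \<in> limiting_normal_cone \<Omega> z"
proof -
  from n obtain u us where z: "z \<in> \<Omega>" and u: "u \<longlonglongrightarrow> z" "\<forall>k. u k \<in> \<Omega>"
    and us: "\<forall>k. us k \<in> regular_normal_cone \<Omega> (u k)" "us \<longlonglongrightarrow> n"
    by (auto simp: limiting_normal_cone_def)
  have "(\<lambda>k. c *\<^sub>R us k) \<longlonglongrightarrow> c *\<^sub>R n" by (intro tendsto_intros us)
  moreover have "\<forall>k. c *\<^sub>R us k \<in> regular_normal_cone \<Omega> (u k)"
    using us c by (blast intro: regular_normal_cone_scaleR)
  ultimately show ?thesis
    unfolding limiting_normal_cone_def using z u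
    by (intro CollectI conjI exI[of _ u] exI[of _ "\<lambda>k. c *\<^sub>R us k"])
qed

text \<open>Each \<open>us k\<close> is approximated by a regular normal within half of the
  tolerance, and \<open>(u k, us k)\<close> is within the other half of \<open>(z, n)\<close>.
  Membership of \<open>z\<close> is assumed because \<Omega> may fail to be closed and the cone is
  empty off \<Omega>.\<close>

lemma limiting_normal_cone_closed_graph:
  assumes z: "z \<in> \<Omega>" and u: "u \<longlonglongrightarrow> z" and us: "us \<longlonglongrightarrow> n"
    and mem: "\<And>k. us k \<in> limiting_normal_cone \<Omega> (u k)"
  shows "n \<in> limiting_normal_cone \<Omega> z"
  unfolding limiting_normal_cone_iff
proof (intro conjI allI impI z)
  fix e :: real assume "e > 0"
  then have e: "e / 2 > 0" by simp
  have "\<forall>\<^sub>F k in sequentially. dist (u k) z < e / 2 \<and> dist (us k) n < e / 2"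
    using tendstoD[OF u e] tendstoD[OF us e] by eventually_elim simp
  then obtain k where k: "dist (u k) z < e / 2" "dist (us k) n < e / 2"
    by (auto simp: eventually_sequentially)
  obtain v m where "v \<in> \<Omega>" "m \<in> regular_normal_cone \<Omega> v" "dist v (u k) < e / 2" "dist m (us k) < e / 2"
    using mem[of k] e unfolding limiting_normal_cone_iff by blast
  moreover from this k have "dist v z < e" "dist m n < e"
    using dist_triangle[of v z "u k"] dist_triangle[of m n "us k"] by auto
  ultimately show "\<exists>v\<in>\<Omega>. \<exists>m\<in>regular_normal_cone \<Omega> v. dist v z < e \<and> dist m n < e"
    by blast
qed

section \<open>Inequalities that characterise regular normals\<close>

text \<open>Along \<open>p + t k *\<^sub>R v k\<close> the right-hand side is quadratic in
  \<open>t k\<close>; division by \<open>t k\<close> leaves a term that vanishes in the limit.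
  Minimisers of quadratic functionals satisfy inequalities of this kind.\<close>

lemma regular_normal_coneI_proximal:
  assumes d: "d > 0"
    and prox: "\<And>q. q \<in> \<Omega> \<Longrightarrow> dist q p < d \<Longrightarrow> n \<bullet> (q - p) \<le> c * (norm (q - p))\<^sup>2"
  shows "n \<in> regular_normal_cone \<Omega> p"
  unfolding regular_normal_cone_def negative_polar_def
proof (intro CollectI ballI)
  fix w assume "w \<in> tangent_cone \<Omega> p"
  then obtain t :: "nat \<Rightarrow> real" and v where t: "\<And>k. t k > 0" "t \<longlonglongrightarrow> 0" and v: "v \<longlonglongrightarrow> w"
    and mem: "\<And>k. p + t k *\<^sub>R v k \<in> \<Omega>"
    by (auto simp: tangent_cone_def)
  have tv: "(\<lambda>k. t k *\<^sub>R v k) \<longlonglongrightarrow> 0"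
    using tendsto_scaleR[OF t(2) v] by simp
  have "\<forall>\<^sub>F k in sequentially. n \<bullet> v k \<le> c * (t k * (norm (v k))\<^sup>2)"
    using tendstoD[OF tv d]
  proof eventually_elim
    case (elim k)
    then have "n \<bullet> (t k *\<^sub>R v k) \<le> c * (norm (t k *\<^sub>R v k))\<^sup>2"
      using prox[OF mem[of k]] by (simp add: dist_norm)
    then have "t k * (n \<bullet> v k) \<le> t k * (c * (t k * (norm (v k))\<^sup>2))"
      by (simp add: power2_eq_square algebra_simps)
    then show ?case using t(1)[of k] by simp
  qed
  moreover have "(\<lambda>k. c * (t k * (norm (v k))\<^sup>2)) \<longlonglongrightarrow> c * (0 * (norm w)\<^sup>2)"
    by (intro tendsto_intros t v)
  moreover have "(\<lambda>k. n \<bullet> v k) \<longlonglongrightarrow> n \<bullet> w"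
    by (intro tendsto_intros v)
  ultimately show "n \<bullet> w \<le> 0"
    by (auto intro: tendsto_le[OF trivial_limit_sequentially])
qed

text \<open>If this fails, there are violating points converging to \<open>p\<close>. By compactness
  of the unit sphere their normalised directions accumulate at a tangent \<open>w\<close> with
  \<open>n \<bullet> w \<ge> e\<close>, contrary to polarity.\<close>

lemma regular_normal_coneD:
  assumes n: "n \<in> regular_normal_cone C p" and e: "e > 0"
  obtains d where "d > 0" "\<And>x. x \<in> C \<Longrightarrow> dist x p \<le> d \<Longrightarrow> n \<bullet> (x - p) \<le> e * norm (x - p)"
proof (rule ccontr)
  assume "\<not> thesis"
  then have "\<forall>d>0. \<exists>x\<in>C. dist x p \<le> d \<and> n \<bullet> (x - p) > e * norm (x - p)"
    using that by (meson not_le)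
  then have "\<forall>k::nat. \<exists>x. x \<in> C \<and> dist x p \<le> inverse (real (Suc k)) \<and> n \<bullet> (x - p) > e * norm (x - p)"
    by (metis inverse_positive_iff_positive of_nat_0_less_iff zero_less_Suc)
  then obtain x where x: "\<And>k::nat. x k \<in> C" "\<And>k. dist (x k) p \<le> inverse (real (Suc k))"
      "\<And>k. n \<bullet> (x k - p) > e * norm (x k - p)"
    by metis
  define t where "t k = norm (x k - p)" for k
  define v where "v k = (x k - p) /\<^sub>R t k" for k
  have t_pos: "t k > 0" for k
    using x(3)[of k] by (auto simp: t_def)
  have "compact (sphere (0::'a) 1)" by simp
  moreover have "\<forall>k. v k \<in> sphere 0 1"
    using t_pos by (auto simp: v_def t_def)
  ultimately obtain w r where r: "strict_mono r" and w: "(v \<circ> r) \<longlonglongrightarrow> w"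
    unfolding compact_def by meson
  have "x \<longlonglongrightarrow> p"
    by (rule LIMSEQ_dist_le_inverse) (rule x(2))
  then have "t \<longlonglongrightarrow> 0"
    unfolding t_def by (simp add: LIM_zero tendsto_norm_zero)
  then have "(t \<circ> r) \<longlonglongrightarrow> 0" using r by (rule LIMSEQ_subseq_LIMSEQ)
  moreover have "p + (t \<circ> r) k *\<^sub>R (v \<circ> r) k \<in> C" for k
    using x(1)[of "r k"] t_pos[of "r k"] by (simp add: v_def)
  ultimately have "w \<in> tangent_cone C p"
    unfolding tangent_cone_def using t_pos w by (intro CollectI exI[of _ "t \<circ> r"] exI[of _ "v \<circ> r"]) auto
  then have "n \<bullet> w \<le> 0" using n by (auto simp: regular_normal_cone_def negative_polar_def)
  moreover have "n \<bullet> (v \<circ> r) k \<ge> e" for k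
  proof -
    have "n \<bullet> (v \<circ> r) k = (n \<bullet> (x (r k) - p)) / t (r k)"
      by (simp add: v_def divide_inverse mult.commute)
    then show ?thesis
      using x(3)[of "r k"] t_pos[of "r k"] by (simp add: t_def pos_le_divide_eq)
  qed
  then have "n \<bullet> w \<ge> e"
    by (intro tendsto_lowerbound[OF tendsto_inner[OF tendsto_const w]]) auto
  ultimately show False using e by simp
qed

section \<open>Approximation of normals to a slice by penalisation\<close>

text \<open>The penalty relaxes the constraint that the second component is zero, and local
  closedness provides minimisers. Only \<xi> is controlled here; \<zeta> carries the penalty weight
  and may be large, which is why a separate bound is required later.\<close>

lemma regular_normal_slice_approx:
  fixes \<Omega> :: "('a::euclidean_space \<times> 'b::euclidean_space) set"
  assumes cl: "locally_closed_at \<Omega> (p, 0)" and p: "(p, 0) \<in> \<Omega>"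
    and n: "n \<in> regular_normal_cone {x. (x, 0) \<in> \<Omega>} p" and e: "e > 0"
  obtains q \<xi> \<zeta> where "q \<in> \<Omega>" "dist q (p, 0) < e" "(\<xi>, \<zeta>) \<in> regular_normal_cone \<Omega> q" "dist \<xi> n < e"
proof -
  obtain r where r: "r > 0" "closed (\<Omega> \<inter> cball (p, 0) r)"
    using cl by (auto simp: locally_closed_at_def)
  obtain d where d: "d > 0"
    and nd: "\<And>x. (x, 0) \<in> \<Omega> \<Longrightarrow> dist x p \<le> d \<Longrightarrow> n \<bullet> (x - p) \<le> e / 4 * norm (x - p)"
    using regular_normal_coneD[OF n, of "e / 4"] e by auto
  define \<rho> where "\<rho> = min r (min d e)"
  have \<rho>: "\<rho> > 0" "\<rho> \<le> r" "\<rho> \<le> d" "\<rho> \<le> e" using r d e by (auto simp: \<rho>_def)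
  \<comment> \<open>This ratio serves twice: the slope \<open>e / 4\<close> becomes the bound
    \<open>\<rho> / 2\<close> on the distance from \<open>x\<close> to \<open>p\<close>, and the
    final error \<open>norm (p - u) / t\<close> is below \<open>e\<close> once
    \<open>norm (p - u) < \<rho>\<close>.\<close>
  define t where "t = \<rho> / e"
  have t: "t > 0" "t * e = \<rho>" using \<rho> e by (auto simp: t_def)
  define a where "a = p + t *\<^sub>R n"
  define K where "K = \<Omega> \<inter> cball (p, 0) \<rho>"
  have "K = (\<Omega> \<inter> cball (p, 0) r) \<inter> cball (p, 0) \<rho>" using \<rho> by (auto simp: K_def)
  then have "compact K" using r by (simp add: closed_Int_compact)
  have pK: "(p, 0) \<in> K" using p \<rho> by (simp add: K_def)
  define g where "g k q = (norm (fst q - a))\<^sup>2 + real k * (norm (snd q))\<^sup>2"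
    for k :: nat and q :: "'a \<times> 'b"
  have "\<exists>q\<in>K. \<forall>q'\<in>K. g k q \<le> g k q'" for k
    unfolding g_def by (rule continuous_attains_inf[OF \<open>compact K\<close>])
      (use pK in \<open>auto intro!: continuous_intros\<close>)
  then obtain m where m: "\<And>k. m k \<in> K" "\<And>k q. q \<in> K \<Longrightarrow> g k (m k) \<le> g k q"
    by metis
  define B where "B = (t * norm n)\<^sup>2"
  have gB: "g k (m k) \<le> B" for k
    using m(2)[OF pK, of k] t by (simp add: g_def B_def a_def)
  obtain q s where s: "strict_mono s" and q: "q \<in> K" "(m \<circ> s) \<longlonglongrightarrow> q"
    using \<open>compact K\<close> m(1) unfolding compact_def by meson
  \<comment> \<open>The penalty term at the minimisers is at most \<open>B\<close>, the value at
    \<open>(p, 0)\<close>, while its weight \<open>s k \<ge> k\<close> is unbounded. Adding the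
    squared norm to both sides replaces \<open>k\<close> by \<open>Suc k\<close> and so avoids
    division by zero.\<close>
  have "snd q = 0"
  proof -
    have "(norm (snd (m (s k))))\<^sup>2 \<le> (B + (norm (snd (m (s k))))\<^sup>2) * inverse (real (Suc k))" for k
    proof -
      have "real k * (norm (snd (m (s k))))\<^sup>2 \<le> real (s k) * (norm (snd (m (s k))))\<^sup>2"
        using seq_suble[OF s, of k] by (intro mult_right_mono) auto
      also have "\<dots> \<le> B" using gB[of "s k"] by (simp add: g_def) (smt (verit) zero_le_power2)
      finally have "(norm (snd (m (s k))))\<^sup>2 * real (Suc k) \<le> B + (norm (snd (m (s k))))\<^sup>2"
        by (simp add: algebra_simps)
      then show ?thesis by (simp add: pos_le_divide_eq flip: divide_inverse del: of_nat_Suc)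
    qed
    moreover have lim: "(\<lambda>k. norm (snd (m (s k)))) \<longlonglongrightarrow> norm (snd q)"
      using q(2) by (auto intro!: tendsto_intros simp: o_def)
    have "(\<lambda>k. (B + (norm (snd (m (s k))))\<^sup>2) * inverse (real (Suc k)))
        \<longlonglongrightarrow> (B + (norm (snd q))\<^sup>2) * 0"
      by (intro tendsto_intros lim LIMSEQ_inverse_real_of_nat)
    ultimately have "(norm (snd q))\<^sup>2 \<le> (B + (norm (snd q))\<^sup>2) * 0"
      using tendsto_power[OF lim, of 2] by (blast intro: LIMSEQ_le)
    then show ?thesis by simp
  qed
  define x where "x = fst q"
  have qx: "q = (x, 0)" using \<open>snd q = 0\<close> by (simp add: x_def prod_eq_iff)
  have "dist x p \<le> d" "(x, 0) \<in> \<Omega>"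
    using q(1) \<rho> by (auto simp: K_def qx dist_Pair_Pair dist_commute)
  then have nx: "n \<bullet> (x - p) \<le> e / 4 * norm (x - p)" by (rule nd[rotated])
  \<comment> \<open>The limit \<open>x\<close> lies in the slice and is at least as close to
    \<open>a\<close> as \<open>p\<close> is. Expanding the square around \<open>p\<close> turns this
    into an upper bound by \<open>n \<bullet> (x - p)\<close>, to which regular normality
    applies.\<close>
  have "(norm (x - a))\<^sup>2 \<le> B"
  proof (rule tendsto_upperbound)
    show "(\<lambda>k. (norm (fst (m (s k)) - a))\<^sup>2) \<longlonglongrightarrow> (norm (x - a))\<^sup>2"
      using q(2) by (auto intro!: tendsto_intros simp: o_def x_def)
    have "(norm (fst (m k) - a))\<^sup>2 \<le> B" for k
      using gB[of k] by (simp add: g_def) (smt (verit) zero_le_power2 mult_nonneg_nonneg of_nat_0_le_iff)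
    then show "\<forall>\<^sub>F k in sequentially. (norm (fst (m (s k)) - a))\<^sup>2 \<le> B" by simp
  qed simp
  moreover have "(norm (x - a))\<^sup>2 = (norm (x - p))\<^sup>2 - 2 * t * (n \<bullet> (x - p)) + B"
    by (simp add: a_def B_def power2_norm_eq_inner power_mult_distrib algebra_simps inner_commute)
      (simp add: power2_eq_square algebra_simps)
  ultimately have "(norm (x - p))\<^sup>2 \<le> 2 * t * (n \<bullet> (x - p))" by simp
  also have "\<dots> \<le> 2 * t * (e / 4 * norm (x - p))"
    using nx t by (intro mult_left_mono) auto
  also have "\<dots> = \<rho> / 2 * norm (x - p)" using t(2) by (simp add: algebra_simps)
  finally have "norm (x - p) \<le> \<rho> / 2"
    using \<rho> by (cases "x = p") (auto simp: power2_eq_square)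
  \<comment> \<open>The limit is interior to the ball, so some minimiser is too. There the ball
    constraint is inactive and only membership in \<Omega> restricts the competitors.\<close>
  then have "dist q (p, 0) < \<rho>" using \<rho> by (simp add: qx dist_Pair_Pair dist_norm)
  then have "\<forall>\<^sub>F k in sequentially. dist ((m \<circ> s) k) (p, 0) < \<rho>"
    using tendsto_dist[OF q(2) tendsto_const] by (rule order_tendstoD(2)[rotated])
  then obtain k where k: "dist (m (s k)) (p, 0) < \<rho>"
    by (auto simp: eventually_sequentially)
  define j where "j = s k"
  obtain u v where uv: "m j = (u, v)" by force
  have dj: "dist (u, v) (p, 0) < \<rho>" using k by (simp add: j_def uv[symmetric])
  \<comment> \<open>Since \<open>a - u = t *\<^sub>R n + (p - u)\<close>, division by
    \<open>t\<close> recovers \<open>n\<close> up to the error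
    \<open>(p - u) /\<^sub>R t\<close>.\<close>
  define \<xi> where "\<xi> = (a - u) /\<^sub>R t"
  define \<zeta> where "\<zeta> = (- (real j *\<^sub>R v)) /\<^sub>R t"
  \<comment> \<open>This vector is minus half the gradient of \<open>g j\<close> at its minimiser.
    The second-order remainders have coefficients \<open>1\<close> and \<open>j\<close>, both
    dominated by \<open>1 + j\<close>.\<close>
  have "(a - u, - (real j *\<^sub>R v)) \<in> regular_normal_cone \<Omega> (u, v)"
  proof (rule regular_normal_coneI_proximal)
    show "\<rho> - dist (u, v) (p, 0) > 0" using dj by simp
    fix q' assume q': "q' \<in> \<Omega>" "dist q' (u, v) < \<rho> - dist (u, v) (p, 0)"
    obtain u' v' where [simp]: "q' = (u', v')" by force
    have "dist q' (p, 0) \<le> \<rho>" using q'(2) dist_triangle[of q' "(p, 0)" "(u, v)"] by linarith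
    then have "q' \<in> K" using q' by (simp add: K_def dist_commute)
    from m(2)[OF this, of j]
    have le: "(norm (u - a))\<^sup>2 + real j * (norm v)\<^sup>2 \<le> (norm (u' - a))\<^sup>2 + real j * (norm v')\<^sup>2"
      by (simp add: g_def uv)
    have 1: "(norm (u' - a))\<^sup>2 = (norm (u - a))\<^sup>2 - 2 * ((a - u) \<bullet> (u' - u)) + (norm (u' - u))\<^sup>2"
      by (simp add: power2_norm_eq_inner algebra_simps inner_commute)
    have 2: "(norm v')\<^sup>2 = (norm v)\<^sup>2 + 2 * (v \<bullet> (v' - v)) + (norm (v' - v))\<^sup>2"
      by (simp add: power2_norm_eq_inner algebra_simps inner_commute)
    have "2 * ((a - u) \<bullet> (u' - u)) - 2 * (real j * (v \<bullet> (v' - v)))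
        \<le> (norm (u' - u))\<^sup>2 + real j * (norm (v' - v))\<^sup>2"
      using le unfolding 1 2 by (simp add: distrib_left)
    also have "\<dots> \<le> (1 + real j) * ((norm (u' - u))\<^sup>2 + (norm (v' - v))\<^sup>2)"
      by (simp add: algebra_simps)
    also have "\<dots> = (1 + real j) * (norm (q' - (u, v)))\<^sup>2"
      by (simp add: norm_Pair)
    finally show "(a - u, - (real j *\<^sub>R v)) \<bullet> (q' - (u, v)) \<le> (1 + real j) / 2 * (norm (q' - (u, v)))\<^sup>2"
      by (simp add: inner_Pair)
  qed
  then have "(\<xi>, \<zeta>) \<in> regular_normal_cone \<Omega> (m j)"
    using regular_normal_cone_scaleR[of _ \<Omega> "(u, v)" "inverse t"] t
    by (fastforce simp: \<xi>_def \<zeta>_def uv)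
  moreover have "m j \<in> \<Omega>" using m(1)[of j] by (simp add: K_def)
  moreover have "dist (m j) (p, 0) < e" using dj \<rho> by (simp add: uv)
  moreover have "dist \<xi> n < e"
  proof -
    have "\<xi> - n = (p - u) /\<^sub>R t" using t by (simp add: \<xi>_def a_def algebra_simps)
    then have "dist \<xi> n = norm (p - u) / t" using t by (simp add: dist_norm divide_inverse mult.commute)
    moreover have "norm (p - u) < t * e"
      using dj dist_fst_le[of "(u, v)" "(p, 0)"] t by (simp add: dist_norm norm_minus_commute)
    ultimately show ?thesis using t(1) by (simp add: pos_divide_less_eq mult.commute)
  qed
  ultimately show thesis using that by blast
qed

section \<open>The qualification condition and limiting normals to the slice\<close>

text \<open>Otherwise there are normals at points tending to \<open>p\<close> whose second component
  dominates the first by arbitrarily large factors. Scaled to a unit second component, they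
  accumulate at a normal \<open>(0, w)\<close> at \<open>p\<close> with \<open>w\<close> of norm
  one.\<close>

lemma normal_bound_of_qualification:
  fixes \<Omega> :: "('a::euclidean_space \<times> 'b::euclidean_space) set"
  assumes p: "p \<in> \<Omega>" and qc: "\<And>\<zeta>. (0, \<zeta>) \<in> limiting_normal_cone \<Omega> p \<Longrightarrow> \<zeta> = 0"
  obtains \<kappa> d where "\<kappa> > 0" "d > 0"
    "\<And>q \<xi> \<zeta>. dist q p < d \<Longrightarrow> (\<xi>, \<zeta>) \<in> limiting_normal_cone \<Omega> q \<Longrightarrow> norm \<zeta> \<le> \<kappa> * norm \<xi>"
proof (rule ccontr)
  note * = that
  assume "\<not> thesis"
  then have H: "\<exists>q \<xi> \<zeta>. dist q p < d \<and> (\<xi>, \<zeta>) \<in> limiting_normal_cone \<Omega> q \<and> norm \<zeta> > \<kappa> * norm \<xi>"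
    if pos: "\<kappa> > 0" "d > 0" for \<kappa> d
    using * pos by (meson not_le)
  have "\<exists>q \<xi> \<zeta>. dist q p < inverse (real (Suc k)) \<and> (\<xi>, \<zeta>) \<in> limiting_normal_cone \<Omega> q
      \<and> norm \<zeta> > real (Suc k) * norm \<xi>" for k
    by (rule H) auto
  then obtain q \<xi> \<zeta> where q: "\<And>k. dist (q k) p < inverse (real (Suc k))"
    and mem: "\<And>k. (\<xi> k, \<zeta> k) \<in> limiting_normal_cone \<Omega> (q k)"
    and big: "\<And>k. norm (\<zeta> k) > real (Suc k) * norm (\<xi> k)"
    by metis
  have pos: "norm (\<zeta> k) > 0" for k
    using big[of k] by (smt (verit) mult_nonneg_nonneg norm_ge_zero of_nat_0_le_iff)
  have "\<zeta> k /\<^sub>R norm (\<zeta> k) \<in> sphere 0 1" for k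
    using pos[of k] by simp
  moreover have "compact (sphere (0::'b) 1)" by simp
  ultimately obtain w r where w: "w \<in> sphere 0 1" and r: "strict_mono r"
    and lim: "((\<lambda>k. \<zeta> k /\<^sub>R norm (\<zeta> k)) \<circ> r) \<longlonglongrightarrow> w"
    unfolding compact_def by meson
  have "q \<longlonglongrightarrow> p"
    by (rule LIMSEQ_dist_le_inverse) (rule less_imp_le[OF q])
  then have qr: "(q \<circ> r) \<longlonglongrightarrow> p" using r by (rule LIMSEQ_subseq_LIMSEQ)
  have "norm (\<xi> k /\<^sub>R norm (\<zeta> k)) \<le> inverse (real (Suc k))" for k
    using big[of k] pos[of k] by (simp add: field_simps)
  then have "(\<lambda>k. \<xi> k /\<^sub>R norm (\<zeta> k)) \<longlonglongrightarrow> 0"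
    by (intro LIMSEQ_dist_le_inverse) (simp del: of_nat_Suc)
  then have \<xi>r: "((\<lambda>k. \<xi> k /\<^sub>R norm (\<zeta> k)) \<circ> r) \<longlonglongrightarrow> 0" using r by (rule LIMSEQ_subseq_LIMSEQ)
  have "(0, w) \<in> limiting_normal_cone \<Omega> p"
  proof (rule limiting_normal_cone_closed_graph[OF p qr tendsto_Pair[OF \<xi>r lim]])
    fix k
    show "(((\<lambda>k. \<xi> k /\<^sub>R norm (\<zeta> k)) \<circ> r) k, ((\<lambda>k. \<zeta> k /\<^sub>R norm (\<zeta> k)) \<circ> r) k)
        \<in> limiting_normal_cone \<Omega> ((q \<circ> r) k)"
      using limiting_normal_cone_scaleR[OF mem[of "r k"], of "inverse (norm (\<zeta> (r k)))"] by simp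
  qed
  then show False using qc w by fastforce
qed

lemma locally_closed_at_nearby:
  assumes r: "closed (\<Omega> \<inter> cball z r)" and z': "dist z' z < r"
  shows "locally_closed_at \<Omega> z'"
  unfolding locally_closed_at_def
proof (intro exI conjI)
  show "r - dist z' z > 0" using z' by simp
  have "cball z' (r - dist z' z) \<subseteq> cball z r"
  proof
    fix y assume "y \<in> cball z' (r - dist z' z)"
    then show "y \<in> cball z r" using dist_triangle[of z y z'] by (simp add: dist_commute)
  qed
  then have "\<Omega> \<inter> cball z' (r - dist z' z) = (\<Omega> \<inter> cball z r) \<inter> cball z' (r - dist z' z)"
    by blast
  then show "closed (\<Omega> \<inter> cball z' (r - dist z' z))" using r by auto
qed

text \<open>Two approximations are composed: regular normals to the slice near \<open>p\<close>,
  then regular normals to \<Omega>. The first components converge, so \<open>bound\<close> keeps the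
  second ones bounded, and a convergent subsequence supplies \<zeta>.\<close>

lemma limiting_normal_cone_slice:
  fixes \<Omega> :: "('a::euclidean_space \<times> 'b::euclidean_space) set"
  assumes r: "0 < r" "closed (\<Omega> \<inter> cball (p, 0) r)"
    and bound: "\<And>q \<xi> \<zeta>. dist q (p, 0) < r \<Longrightarrow> (\<xi>, \<zeta>) \<in> limiting_normal_cone \<Omega> q \<Longrightarrow> norm \<zeta> \<le> \<kappa> * norm \<xi>"
    and n: "n \<in> limiting_normal_cone {x. (x, 0) \<in> \<Omega>} p"
  obtains \<zeta> where "(n, \<zeta>) \<in> limiting_normal_cone \<Omega> (p, 0)"
proof -
  have p: "(p, 0) \<in> \<Omega>" using n by (simp add: limiting_normal_cone_iff)
  have approx: "\<exists>q \<xi> \<zeta>. q \<in> \<Omega> \<and> dist q (p, 0) < e \<and> (\<xi>, \<zeta>) \<in> regular_normal_cone \<Omega> q \<and> dist \<xi> n < e"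
    if e: "e > 0" for e
  proof -
    \<comment> \<open>Half of the tolerance goes to each approximation; \<open>r\<close> keeps
      \<open>x\<close> where local closedness is inherited.\<close>
    have "min (e / 2) r > 0" using e r by simp
    then have "\<exists>x\<in>{x. (x, 0) \<in> \<Omega>}. \<exists>m\<in>regular_normal_cone {x. (x, 0) \<in> \<Omega>} x.
        dist x p < min (e / 2) r \<and> dist m n < min (e / 2) r"
      using n unfolding limiting_normal_cone_iff by blast
    then obtain x m where x: "(x, 0) \<in> \<Omega>" "m \<in> regular_normal_cone {x. (x, 0) \<in> \<Omega>} x"
      "dist x p < min (e / 2) r" "dist m n < min (e / 2) r"
      by blast
    have dx: "dist (x, 0::'b) (p, 0) < min (e / 2) r" using x by (simp add: dist_Pair_Pair)
    have lc: "locally_closed_at \<Omega> (x, 0)"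
      using dx by (intro locally_closed_at_nearby[OF r(2)]) simp
    obtain q \<xi> \<zeta> where "q \<in> \<Omega>" "dist q (x, 0) < e / 2" "(\<xi>, \<zeta>) \<in> regular_normal_cone \<Omega> q" "dist \<xi> m < e / 2"
      using regular_normal_slice_approx[OF lc x(1,2) half_gt_zero[OF e]] by metis
    moreover from this dx have "dist q (p, 0) < e" "dist \<xi> n < e"
      using x(4) dist_triangle[of q "(p, 0)" "(x, 0)"] dist_triangle[of \<xi> n m] by auto
    ultimately show ?thesis by blast
  qed
  \<comment> \<open>The minimum with \<open>r\<close> keeps \<open>q k\<close> in the region where
    \<open>bound\<close> applies.\<close>
  have "\<exists>q \<xi> \<zeta>. q \<in> \<Omega> \<and> dist q (p, 0) < min r (inverse (real (Suc k))) \<and>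
      (\<xi>, \<zeta>) \<in> regular_normal_cone \<Omega> q \<and> dist \<xi> n < min r (inverse (real (Suc k)))" for k
    by (rule approx) (use r in auto)
  then obtain q \<xi> \<zeta> where q: "\<And>k. q k \<in> \<Omega>" "\<And>k. dist (q k) (p, 0) < min r (inverse (real (Suc k)))"
    and reg: "\<And>k. (\<xi> k, \<zeta> k) \<in> regular_normal_cone \<Omega> (q k)"
    and \<xi>: "\<And>k. dist (\<xi> k) n < min r (inverse (real (Suc k)))"
    by metis
  have lim_n: "(\<xi> k, \<zeta> k) \<in> limiting_normal_cone \<Omega> (q k)" for k
    using regular_subset_limiting_normal_cone[OF q(1)] reg by blast
  have q_lim: "q \<longlonglongrightarrow> (p, 0)"
    by (rule LIMSEQ_dist_le_inverse) (use q(2) less_imp_le in fastforce)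
  have \<xi>_lim: "\<xi> \<longlonglongrightarrow> n"
    by (rule LIMSEQ_dist_le_inverse) (use \<xi> less_imp_le in fastforce)
  then have "Bseq \<xi>" by (rule convergent_imp_Bseq[OF convergentI])
  then obtain M where M: "\<And>k. norm (\<xi> k) \<le> M" by (auto simp: Bseq_def)
  \<comment> \<open>The absolute value appears because \<kappa> has no assumed sign.\<close>
  have "norm (\<zeta> k) \<le> \<bar>\<kappa>\<bar> * M" for k
  proof -
    have "norm (\<zeta> k) \<le> \<kappa> * norm (\<xi> k)" using bound[OF _ lim_n] q(2)[of k] by simp
    also have "\<dots> \<le> \<bar>\<kappa>\<bar> * M" using M by (intro mult_mono) auto
    finally show ?thesis .
  qed
  then have "\<forall>k. \<zeta> k \<in> cball 0 (\<bar>\<kappa>\<bar> * M)" by simp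
  moreover have "compact (cball (0::'b) (\<bar>\<kappa>\<bar> * M))" by simp
  ultimately obtain w s where s: "strict_mono s" and w: "(\<zeta> \<circ> s) \<longlonglongrightarrow> w"
    unfolding compact_def by meson
  have "(n, w) \<in> limiting_normal_cone \<Omega> (p, 0)"
    by (rule limiting_normal_cone_closed_graph[OF p LIMSEQ_subseq_LIMSEQ[OF q_lim s]
          tendsto_Pair[OF LIMSEQ_subseq_LIMSEQ[OF \<xi>_lim s] w]]) (simp add: lim_n)
  then show thesis by (rule that)
qed

section \<open>The solution map: normals to its graph and semismoothness\<close>

lemma gph_solution_map: "gph (solution_map F) = {p. (p, 0) \<in> gph F}"
  by (auto simp: gph_def solution_map_def)

text \<open>The coderivative negates its argument, so \<zeta> stands for \<open>- zs\<close>; the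
  existential quantifier absorbs the sign.\<close>

lemma mem_Gamma_incl_iff:
  "(ys, xs) \<in> Gamma_incl F p \<longleftrightarrow> (\<exists>\<zeta>. ((xs, - ys), \<zeta>) \<in> limiting_normal_cone (gph F) (p, 0))"
  by (cases p) (auto simp: Gamma_incl_def Sigma_incl_def coderivative_def intro: exI[of _ "- _"])

lemma cone_Gamma_incl: "cone (Gamma_incl F p)"
  unfolding cone_def
proof (intro ballI allI impI)
  fix v and c :: real assume v: "v \<in> Gamma_incl F p" and c: "0 \<le> c"
  obtain ys xs where [simp]: "v = (ys, xs)" by force
  from v obtain \<zeta> where "((xs, - ys), \<zeta>) \<in> limiting_normal_cone (gph F) (p, 0)"
    by (auto simp: mem_Gamma_incl_iff)
  from limiting_normal_cone_scaleR[OF this c] show "c *\<^sub>R v \<in> Gamma_incl F p"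
    by (auto simp: mem_Gamma_incl_iff)
qed

text \<open>On the slice the third variable is zero, so the term with \<open>zs\<close> drops out of
  the estimate for \<open>F\<close>, and pairing \<open>(xs, - ys)\<close> with the displacement
  gives exactly the expression for the solution map. What remains is the norm of the dual vector,
  which still contains \<zeta>; \<open>bound\<close> removes it.\<close>

lemma semismooth_star_wrt_Gamma_incl:
  fixes F :: "'a::euclidean_space \<times> 'b::euclidean_space \<Rightarrow> 'c::euclidean_space set"
  assumes ss: "semismooth_star F (x, y) 0" and d: "d > 0" and \<kappa>: "\<kappa> > 0"
    and bound: "\<And>q \<xi> \<zeta>. dist q ((x, y), 0) < d \<Longrightarrow> (\<xi>, \<zeta>) \<in> limiting_normal_cone (gph F) q
      \<Longrightarrow> norm \<zeta> \<le> \<kappa> * norm \<xi>"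
  shows "semismooth_star_wrt (solution_map F) (Gamma_incl F) x y"
  unfolding semismooth_star_wrt_def
proof (intro conjI allI impI)
  show "(x, y) \<in> gph (solution_map F)"
    using ss by (simp add: semismooth_star_def semismooth_star_wrt_def gph_solution_map)
  show "cone (Gamma_incl F p)" for p by (rule cone_Gamma_incl)
  \<comment> \<open>Zero is a normal at every point of the graph, so the domain condition holds
    globally.\<close>
  have "(0, 0) \<in> Gamma_incl F p" if "p \<in> gph (solution_map F)" for p
    using that regular_subset_limiting_normal_cone[of "(p, 0)" "gph F"]
      zero_in_regular_normal_cone[of "gph F" "(p, 0)"]
    by (auto simp: mem_Gamma_incl_iff gph_solution_map zero_prod_def)
  then show "\<exists>N. open N \<and> (x, y) \<in> N \<and> gph (solution_map F) \<inter> N \<subseteq> mdom (Gamma_incl F)"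
    by (intro exI[of _ UNIV]) (auto simp: mdom_def)
  fix \<epsilon> :: real assume "\<epsilon> > 0"
  \<comment> \<open>The factor \<open>1 + \<kappa>\<close> is the cost of bounding the norm of
    \<open>(- \<zeta>, xs, - ys)\<close> by that of \<open>(ys, xs)\<close>.\<close>
  then have "\<epsilon> / (1 + \<kappa>) > 0" using \<kappa> by simp
  then have "\<exists>\<delta>>0. \<forall>(q, z)\<in>gph F. norm ((q, z) - ((x, y), 0)) \<le> \<delta> \<longrightarrow>
      (\<forall>(zs, xs)\<in>gph (coderivative F q z).
        \<bar>xs \<bullet> (q - (x, y)) - zs \<bullet> (z - 0)\<bar> \<le> \<epsilon> / (1 + \<kappa>) * norm ((q, z) - ((x, y), 0)) * norm (zs, xs))"
    using ss unfolding semismooth_star_def semismooth_star_wrt_def prod.case by blast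
  then obtain \<delta> where \<delta>: "\<delta> > 0" and F: "\<And>q z zs xs. (q, z) \<in> gph F \<Longrightarrow> norm ((q, z) - ((x, y), 0)) \<le> \<delta>
      \<Longrightarrow> xs \<in> coderivative F q z zs \<Longrightarrow>
      \<bar>xs \<bullet> (q - (x, y)) - zs \<bullet> (z - 0)\<bar> \<le> \<epsilon> / (1 + \<kappa>) * norm ((q, z) - ((x, y), 0)) * norm (zs, xs)"
    unfolding gph_def[of "coderivative F _ _"] by blast
  show "\<exists>\<delta>>0. \<forall>(u, v)\<in>gph (solution_map F). norm ((u, v) - (x, y)) \<le> \<delta> \<longrightarrow>
        (\<forall>(ys, xs)\<in>Gamma_incl F (u, v). \<bar>xs \<bullet> (u - x) - ys \<bullet> (v - y)\<bar>
             \<le> \<epsilon> * norm ((u, v) - (x, y)) * norm (ys, xs))"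
  \<comment> \<open>Halving \<open>d\<close> turns the non-strict condition on the distance into the
    strict one that \<open>bound\<close> requires.\<close>
  proof (intro exI[of _ "min \<delta> (d / 2)"] conjI ballI, goal_cases)
    case 1
    show ?case using \<delta> d by simp
  next
    case (2 p)
    obtain u v where [simp]: "p = (u, v)" by force
    have "\<bar>xs \<bullet> (u - x) - ys \<bullet> (v - y)\<bar> \<le> \<epsilon> * norm ((u, v) - (x, y)) * norm (ys, xs)"
      if near: "norm ((u, v) - (x, y)) \<le> min \<delta> (d / 2)" and mem: "(ys, xs) \<in> Gamma_incl F (u, v)" for ys xs
    proof -
      obtain \<zeta> where \<zeta>: "((xs, - ys), \<zeta>) \<in> limiting_normal_cone (gph F) ((u, v), 0)"
        using mem by (auto simp: mem_Gamma_incl_iff)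
      have "dist ((u, v), 0::'c) ((x, y), 0) < d"
        using near d by (simp add: dist_norm norm_Pair)
      then have "norm \<zeta> \<le> \<kappa> * norm (xs, - ys)" using bound \<zeta> by blast
      then have "norm (- \<zeta>, xs, - ys) \<le> (1 + \<kappa>) * norm (ys, xs)"
        using norm_Pair_le[of "- \<zeta>" "(xs, - ys)"] by (simp add: norm_Pair algebra_simps)
      then have "\<epsilon> / (1 + \<kappa>) * norm ((u, v) - (x, y)) * norm (- \<zeta>, xs, - ys)
          \<le> \<epsilon> / (1 + \<kappa>) * norm ((u, v) - (x, y)) * ((1 + \<kappa>) * norm (ys, xs))"
        using \<open>\<epsilon> > 0\<close> \<kappa> by (intro mult_left_mono) auto
      also have "\<dots> = \<epsilon> * norm ((u, v) - (x, y)) * norm (ys, xs)"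
        using \<kappa> by (simp add: field_simps)
      finally show ?thesis
        using F[of "(u, v)" 0 "(xs, - ys)" "- \<zeta>"] 2 near \<zeta>
        by (simp add: gph_solution_map coderivative_def norm_Pair)
    qed
    then show ?case by auto
  qed
qed

theorem theorem5p1:
  fixes F :: "(real ^ 'n) \<times> (real ^ 'm) \<Rightarrow> (real ^ 'l) set"
    and xb :: "real ^ 'n" and yb :: "real ^ 'm"
  assumes closed: "locally_closed_at (gph F) ((xb, yb), 0)"
    and sol: "(xb, yb) \<in> gph (solution_map F)"
    and qc: "\<forall>zs. (0, 0) \<in> coderivative F (xb, yb) 0 zs \<longrightarrow> zs = 0"
  shows "\<exists>U. open U \<and> (xb, yb) \<in> U \<and>
    (\<forall>(x, y) \<in> gph (solution_map F) \<inter> U.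
       (\<forall>ys. coderivative (solution_map F) x y ys \<subseteq> Sigma_incl F x y ys) \<and>
       (semismooth_star F (x, y) 0 \<longrightarrow>
          semismooth_star_wrt (solution_map F) (Gamma_incl F) x y))"
proof -
  have "\<zeta> = 0" if "(0, \<zeta>) \<in> limiting_normal_cone (gph F) ((xb, yb), 0)" for \<zeta>
    using qc[rule_format, of "- \<zeta>"] that by (simp add: coderivative_def zero_prod_def)
  with sol obtain \<kappa> d where \<kappa>: "\<kappa> > 0" and d: "d > 0"
    and bound: "\<And>q \<xi> \<zeta>. dist q ((xb, yb), 0) < d \<Longrightarrow> (\<xi>, \<zeta>) \<in> limiting_normal_cone (gph F) q
      \<Longrightarrow> norm \<zeta> \<le> \<kappa> * norm \<xi>"
    using normal_bound_of_qualification[of "((xb, yb), 0)" "gph F"]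
    by (auto simp: gph_solution_map)
  obtain r where r: "r > 0" "closed (gph F \<inter> cball ((xb, yb), 0) r)"
    using closed by (auto simp: locally_closed_at_def)
  \<comment> \<open>Within \<open>d\<close> the bound on normals holds, and within \<open>r\<close>
    local closedness passes to nearby points.\<close>
  define U where "U = ball (xb, yb) (min d r)"
  have "(\<forall>ys. coderivative (solution_map F) x y ys \<subseteq> Sigma_incl F x y ys) \<and>
       (semismooth_star F (x, y) 0 \<longrightarrow> semismooth_star_wrt (solution_map F) (Gamma_incl F) x y)"
    if U: "(x, y) \<in> U" for x y
  proof (intro conjI allI subsetI impI)
    have dxy: "dist ((x, y), 0::real^'l) ((xb, yb), 0) < min d r"
      using U by (simp add: U_def dist_Pair_Pair dist_commute)
    have "locally_closed_at (gph F) ((x, y), 0)"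
      using dxy by (intro locally_closed_at_nearby[OF r(2)]) simp
    then obtain r' where r': "r' > 0" "closed (gph F \<inter> cball ((x, y), 0) r')"
      by (auto simp: locally_closed_at_def)
    \<comment> \<open>A single radius around \<open>(x, y)\<close> must give both closedness and the
      bound: the first entry ensures closedness, the second keeps the new ball inside the old one of
      radius \<open>d\<close>.\<close>
    define s where "s = min r' (d - dist ((x, y), 0::real^'l) ((xb, yb), 0))"
    have s: "s > 0" using r' dxy by (simp add: s_def)
    have "gph F \<inter> cball ((x, y), 0) s = (gph F \<inter> cball ((x, y), 0) r') \<inter> cball ((x, y), 0) s"
      by (auto simp: s_def)
    then have s_closed: "closed (gph F \<inter> cball ((x, y), 0) s)" using r' by auto
    have s_bound: "norm \<zeta> \<le> \<kappa> * norm \<xi>"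
      if "dist q ((x, y), 0) < s" "(\<xi>, \<zeta>) \<in> limiting_normal_cone (gph F) q" for q \<xi> \<zeta>
      using that dist_triangle[of q "((xb, yb), 0)" "((x, y), 0)"]
      by (intro bound[of q]) (auto simp: s_def)
    {
      fix ys xs assume "xs \<in> coderivative (solution_map F) x y ys"
      then have n: "(xs, - ys) \<in> limiting_normal_cone {p. (p, 0) \<in> gph F} (x, y)"
        by (simp add: coderivative_def gph_solution_map)
      obtain \<zeta> where "((xs, - ys), \<zeta>) \<in> limiting_normal_cone (gph F) ((x, y), 0)"
        by (rule limiting_normal_cone_slice[OF s s_closed _ n]) (use s_bound in \<open>blast+\<close>)
      then have "(ys, xs) \<in> Gamma_incl F (x, y)"
        by (auto simp: mem_Gamma_incl_iff)
      then show "xs \<in> Sigma_incl F x y ys" by (simp add: Gamma_incl_def)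
    }
    show "semismooth_star_wrt (solution_map F) (Gamma_incl F) x y" if "semismooth_star F (x, y) 0"
      by (rule semismooth_star_wrt_Gamma_incl[OF that s \<kappa>]) (use s_bound in blast)
  qed
  moreover have "open U" "(xb, yb) \<in> U" using d r by (auto simp: U_def)
  ultimately show ?thesis by blast
qed

end
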